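(* Let $m\ge 0$ be an integer and let $a_*$ be a global minimizer of $\mathcal V$ over all nonzero real polynomials of degree at most $m$. Let $\mu_*=Q_2(a_* )/Q_1(a_* )$, $\rho_*=\rho(a_* )$, $\eta_*=\rho_*\mu_*^2$ and $R_*(t)=(t-\mu_* )^2-\eta_*$. Then $$\deg a_*=m,\qquad R_*(t)a_*(t)=c\,L_{m+2}(t)$$ for some nonzero real constant $c$. Moreover there is an index $j\in\{1,\dots,m+1\}$ such that $$R_*(t)=(t-x_{j,m+2})(t-x_{j+1,m+2}),\qquad a_*(t)=C\,\frac{L_{m+2}(t)}{(t-x_{j,m+2})(t-x_{j+1,m+2})}$$ for some nonzero real constant $C$. The deleted pair $(x_{j,m+2},x_{j+1,m+2})$ attains the minimum defining $\Delta_{m+2}$, and $$\mathfrak v_m=\mathcal V(a_* )=\Delta_{m+2}=\min_{1\le r\le m+1}\frac{(x_{r+1,m+2}-x_{r,m+2})^2}{4\,x_{r,m+2}\,x_{r+1,m+2}} .$$ For $m=0$ this reads $\mathfrak v_0=\Delta_2=1$: the half-polynomial is constant (unique up to a scalar) and the mean-one kernel is the unit exponential density $e^{-u}$. Write $n=m+2$, $x=x_{j,n}$, $y=x_{j+1,n}$ for the minimizing pair. Then the normalized unit-damping density is $$\kappa_{1,a_*}(z)=\frac{xy(y-x)^2}{x+y}\,e^{-z}\left[\frac{L_n(z)}{(z-x)(z-y)}\right]^2,\qquad z\ge 0,$$ and a random variable $T_{a_*}$ with this density satisfies $\mathbb E[T_{a_*}]=\frac{2xy}{x+y}$ and $\mathbb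 E[T_{a_*}^2]=xy$. Choosing $\lambda_{m,j}=\frac{2xy}{x+y}$ produces the optimal mean-one kernel $$\kappa^*_{m,j}(u)=\lambda_{m,j}\frac{xy(y-x)^2}{x+y}\,e^{-\lambda_{m,j}u}\left[\frac{L_n(\lambda_{m,j}u)}{(\lambda_{m,j}u-x)(\lambda_{m,j}u-y)}\right]^2,\qquad u\ge0$$ (removable singularities filled in), for which $\int_0^\infty\kappa^*_{m,j}(u)\,du=1$ and a random variable $U^*_{m,j}$ with this density satisfies $\mathbb E[U^*_{m,j}]=1$ and $\operatorname{Var}(U^*_{m,j})=\gamma_{j,n}=\Delta_n$. No kernel $\kappa_{\lambda(a),a}$ with $a$ a real polynomial of exact degree $m$ has smaller variance, and every variance-minimizing kernel in this class arises in this way from one adjacent pair attaining the minimum $\Delta_{m+2}$, with its half-polynomial determined up to a nonzero real scalar multiple.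
   Context: For a nonzero real polynomial $a$ and $k=0,1,2$ set $Q_k(a)=\int_0^\infty z^k e^{-z}a(z)^2\,dz$. For $\lambda>0$ define the probability density $\kappa_{\lambda,a}(u)=\lambda e^{-\lambda u}a(\lambda u)^2/Q_0(a)$, $u\ge 0$. $T_a$ denotes a random variable with density $\kappa_{1,a}$, and $U_{\lambda,a}=T_a/\lambda$ has density $\kappa_{\lambda,a}$. The unique scale giving mean one is $\lambda(a)=Q_1(a)/Q_0(a)$. The objective is $$\mathcal V(a)=\operatorname{Var}(U_{\lambda(a),a})=\frac{Q_0(a)Q_2(a)}{Q_1(a)^2}-1=\frac{\operatorname{Var}(T_a)}{\mathbb E[T_a]^2},$$ and $\rho(a)=1-\frac{Q_1(a)^2}{Q_0(a)Q_2(a)}$. The optimal variance is $\mathfrak v_m=\inf\{\mathcal V(a): a \text{ a real polynomial of exact degree } m\}$. $L_n(t)=\sum_{j=0}^n(-1)^j\binom nj\frac{t^j}{j!}$ is the ordinary Laguerre polynomial, with zeros $0<x_{1,n}<\cdots<x_{n,n}$. For $1\le j<n$, $\gamma_{j,n}=\frac{(x_{j+1,n}-x_{j,n})^2}{4x_{j,n}x_{j+1,n}}$, and $\Delta_n=\min_{1\le j<n}\gamma_{j,n}$ ($n\ge2$). Quotients of $L_n$ by linear factors at its zeros are understood as polynomials. *)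

theory Defs
  imports "HOL-Probability.Probability" "HOL-Computational_Algebra.Polynomial"
begin

definition Q :: "nat \<Rightarrow> real poly \<Rightarrow> real" where
  "Q k a = (LINT z:{0..}|lborel. z ^ k * exp (- z) * (poly a z)\<^sup>2)"

text \<open>Densities on the half-line are extended by zero to the whole real line.\<close>

definition kappa :: "real \<Rightarrow> real poly \<Rightarrow> real \<Rightarrow> real" where
  "kappa l a u = (if 0 \<le> u then l * exp (- (l * u)) * (poly a (l * u))\<^sup>2 / Q 0 a else 0)"

text \<open>
  A random variable with density \<open>f\<close> is represented by the identity function on the
  probability space \<open>law f\<close>. Moments do not depend on this choice, by
  \<open>distributed_expectation_law\<close> and \<open>distributed_variance_law\<close> below.
\<close>

definition law :: "(real \<Rightarrow> real) \<Rightarrow> real measure" where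
  "law f = density lborel (\<lambda>u. ennreal (f u))"

definition law_mean :: "(real \<Rightarrow> real) \<Rightarrow> real" where
  "law_mean f = prob_space.expectation (law f) (\<lambda>u. u)"

definition law_variance :: "(real \<Rightarrow> real) \<Rightarrow> real" where
  "law_variance f = prob_space.variance (law f) (\<lambda>u. u)"

lemma distributed_expectation_law:
  fixes g :: "real \<Rightarrow> real"
  assumes "distributed M lborel X (\<lambda>u. ennreal (f u))" and "g \<in> borel_measurable borel"
  shows "prob_space.expectation M (\<lambda>w. g (X w)) = prob_space.expectation (law f) g"
proof -
  have "X \<in> measurable M lborel"
    using assms(1) by (simp add: distributed_def)
  moreover have "g \<in> borel_measurable lborel"
    using assms(2) by simp
  ultimately have "integral\<^sup>L (distr M lborel X) g = integral\<^sup>L M (\<lambda>w. g (X w))"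
    by (rule integral_distr)
  then show ?thesis
    using distributed_distr_eq_density[OF assms(1)] by (simp add: law_def)
qed

lemma distributed_variance_law:
  assumes "distributed M lborel X (\<lambda>u. ennreal (f u))"
  shows "prob_space.variance M X = law_variance f"
  using distributed_expectation_law[OF assms, of "\<lambda>u. u"]
    distributed_expectation_law[OF assms, of "\<lambda>u. (u - law_mean f)\<^sup>2"]
  by (simp add: law_variance_def law_mean_def)

definition mean_one_scale :: "real poly \<Rightarrow> real" where
  "mean_one_scale a = Q 1 a / Q 0 a"

definition objective :: "real poly \<Rightarrow> real" where
  "objective a = law_variance (kappa (mean_one_scale a) a)"

definition rho :: "real poly \<Rightarrow> real" where
  "rho a = 1 - (Q 1 a)\<^sup>2 / (Q 0 a * Q 2 a)"

definition optimal_variance :: "nat \<Rightarrow> real" where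
  "optimal_variance m = Inf (objective ` {a. a \<noteq> 0 \<and> degree a = m})"

definition global_minimizer :: "nat \<Rightarrow> real poly \<Rightarrow> bool" where
  "global_minimizer m a \<longleftrightarrow> a \<noteq> 0 \<and> degree a \<le> m \<and>
     (\<forall>b. b \<noteq> 0 \<and> degree b \<le> m \<longrightarrow> objective a \<le> objective b)"

definition mean_one_kernels :: "nat \<Rightarrow> (real \<Rightarrow> real) set" where
  "mean_one_kernels m = {kappa (mean_one_scale a) a | a. a \<noteq> 0 \<and> degree a = m}"

definition laguerre :: "nat \<Rightarrow> real poly" where
  "laguerre n = (\<Sum>j\<le>n. monom ((-1) ^ j * real (n choose j) / fact j) j)"

text \<open>The zeros are numbered increasingly from \<open>1\<close> to \<open>n\<close>; list positions start at \<open>0\<close>.\<close>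

definition lzero :: "nat \<Rightarrow> nat \<Rightarrow> real" where
  "lzero j n = sorted_list_of_set {t. poly (laguerre n) t = 0} ! (j - 1)"

definition gap :: "nat \<Rightarrow> nat \<Rightarrow> real" where
  "gap j n = (lzero (j + 1) n - lzero j n)\<^sup>2 / (4 * lzero j n * lzero (j + 1) n)"

definition min_gap :: "nat \<Rightarrow> real" where
  "min_gap n = Min ((\<lambda>j. gap j n) ` {1..<n})"

definition pair_poly :: "nat \<Rightarrow> nat \<Rightarrow> real poly" where
  "pair_poly j n = [:- lzero j n, 1:] * [:- lzero (j + 1) n, 1:]"

text \<open>The quotient is taken in the polynomial ring, so no singularities arise at the two zeros.\<close>

definition deleted_pair :: "nat \<Rightarrow> nat \<Rightarrow> real poly" where
  "deleted_pair j n = laguerre n div pair_poly j n"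

definition pair_const :: "nat \<Rightarrow> nat \<Rightarrow> real" where
  "pair_const j n = (let x = lzero j n; y = lzero (j + 1) n in x * y * (y - x)\<^sup>2 / (x + y))"

definition pair_scale :: "nat \<Rightarrow> nat \<Rightarrow> real" where
  "pair_scale j n = (let x = lzero j n; y = lzero (j + 1) n in 2 * x * y / (x + y))"

definition optimal_kernel :: "nat \<Rightarrow> nat \<Rightarrow> real \<Rightarrow> real" where
  "optimal_kernel m j u =
     (if 0 \<le> u
      then pair_scale j (m + 2) * pair_const j (m + 2) * exp (- (pair_scale j (m + 2) * u))
             * (poly (deleted_pair j (m + 2)) (pair_scale j (m + 2) * u))\<^sup>2
      else 0)"

end

theory Submission
  imports Defs
begin

text \<open>
  Write \<open>E p\<close> (below \<open>wint\<close>) for the integral of \<open>p(t) e\<^sup>-\<^sup>t\<close> over the half-line; integration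
  by parts reads \<open>E p' = E p - p(0)\<close>. For a minimizer \<open>a\<close> and
  \<open>R = (t - \<mu>)\<^sup>2 - \<eta>\<close> the quadratic form \<open>E (R h\<^sup>2)\<close> is
  nonnegative on polynomials \<open>h\<close> of degree at most \<open>m\<close> and vanishes at \<open>a\<close>, so \<open>R a\<close> is orthogonal to
  all of them. If \<open>a\<close> had degree less than \<open>m\<close>, the second variation in the direction \<open>t (a - a')\<close>,
  combined with a change of the scale parameter, would be negative. Hence \<open>deg a = m\<close>, and testing
  stationarity with \<open>t a'\<close> shows that \<open>R a\<close> is orthogonal to \<open>t a\<close> as well, so that it is a multiple
  of the Laguerre polynomial of degree \<open>m + 2\<close>. A zero \<open>z\<close> of it strictly between the two roots of
  \<open>R\<close> is impossible: with \<open>h = a / (t - z)\<close> one has \<open>R(z) E (R h\<^sup>2) = E ((R h)\<^sup>2) > 0\<close>, while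
  \<open>R(z) < 0\<close>. The moments of the Laguerre polynomial with a consecutive pair of zeros deleted follow
  from orthogonality by integration by parts.
\<close>

section \<open>Exponential moments of polynomials\<close>

definition wint :: "real poly \<Rightarrow> real" where
  "wint p = (LINT z:{0..}|lborel. exp (- z) * poly p z)"

lemma has_integral_power_exp:
  "has_bochner_integral lborel (\<lambda>z::real. indicator {0..} z * (exp (- z) * z ^ k)) (fact k)"
proof (rule has_bochner_integral_nn_integral)
  have "(\<integral>\<^sup>+z. ennreal (indicator {0..} z * (exp (- z) * z ^ k)) \<partial>lborel)
      = (\<integral>\<^sup>+z. ennreal (z ^ k * exp (- z)) * indicator {0..} z \<partial>lborel)"
    by (intro nn_integral_cong) (auto simp: indicator_def mult.commute)
  then show "(\<integral>\<^sup>+z. ennreal (indicator {0..} z * (exp (- z) * z ^ k)) \<partial>lborel) = ennreal (fact k)"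
    by (simp add: nn_intergal_power_times_exp_Ici)
qed (auto simp: indicator_def)

lemma has_integral_poly_exp:
  "has_bochner_integral lborel (\<lambda>z::real. indicator {0..} z * (exp (- z) * poly p z))
     (\<Sum>k\<le>degree p. coeff p k * fact k)"
proof -
  have "has_bochner_integral lborel
      (\<lambda>z::real. \<Sum>k\<le>degree p. coeff p k * (indicator {0..} z * (exp (- z) * z ^ k)))
      (\<Sum>k\<le>degree p. coeff p k * fact k)"
    by (intro has_bochner_integral_sum has_bochner_integral_mult_right has_integral_power_exp)
  then show ?thesis
    by (simp add: poly_altdef sum_distrib_left mult_ac)
qed

lemma wint_eq_sum: "wint p = (\<Sum>k\<le>degree p. coeff p k * fact k)"
  using has_integral_poly_exp[of p]
  by (simp add: wint_def set_lebesgue_integral_def has_bochner_integral_iff)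

lemma has_integral_wint:
  "has_bochner_integral lborel (\<lambda>z::real. indicator {0..} z * (exp (- z) * poly p z)) (wint p)"
  using has_integral_poly_exp[of p] by (simp add: wint_eq_sum)

lemma wint_add [simp]: "wint (p + q) = wint p + wint q"
  using has_bochner_integral_add[OF has_integral_wint[of p] has_integral_wint[of q]]
    has_integral_wint[of "p + q"]
  by (simp add: has_bochner_integral_iff ring_distribs)

lemma wint_smult [simp]: "wint (smult c p) = c * wint p"
  using has_bochner_integral_mult_right[OF has_integral_wint[of p], of c]
    has_integral_wint[of "smult c p"]
  by (auto simp: has_bochner_integral_iff mult_ac)

lemma wint_0 [simp]: "wint 0 = 0"
  by (simp add: wint_eq_sum)

lemma wint_minus [simp]: "wint (- p) = - wint p"
  using wint_smult[of "-1" p] by simp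

lemma wint_diff [simp]: "wint (p - q) = wint p - wint q"
  using wint_add[of p "- q"] by simp

lemma wint_const_mult [simp]: "wint ([:c:] * p) = c * wint p"
  by simp

lemma wint_mult_const [simp]: "wint (p * [:c:]) = c * wint p"
  by (simp add: mult.commute)

lemma wint_numeral_mult [simp]: "wint (numeral k * p) = numeral k * wint p"
  by (simp add: numeral_poly)

lemma wint_monom [simp]: "wint (monom c k) = c * fact k"
proof (cases "c = 0")
  case False
  then have "wint (monom c k) = (\<Sum>i\<le>k. if i = k then c * fact k else 0)"
    unfolding wint_eq_sum by (intro sum.cong) (auto simp: degree_monom_eq)
  then show ?thesis
    by simp
qed simp

lemma poly_monom_induct [case_names monom add]:
  fixes p :: "'a::comm_monoid_add poly"
  assumes "\<And>c k. P (monom c k)" and "\<And>p q. P p \<Longrightarrow> P q \<Longrightarrow> P (p + q)"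
  shows "P p"
proof -
  have "P (\<Sum>i\<le>n. monom (coeff p i) i)" for n
    by (induction n) (auto intro: assms)
  then show ?thesis
    using poly_as_sum_of_monoms[of p] by metis
qed

text \<open>Both sides are additive, so monomials suffice: for k > 0 the moment
  \<open>c * fact k\<close> is unchanged by differentiation, and for k = 0 the boundary value
  cancels it.\<close>

lemma wint_pderiv: "wint (pderiv p) = wint p - poly p 0"
proof (induction p rule: poly_monom_induct)
  case (monom c k)
  then show ?case
    by (cases k) (auto simp: pderiv_monom poly_monom algebra_simps)
next
  case (add p q)
  then show ?case
    by (simp add: pderiv_add)
qed

lemma wint_pos:
  assumes "\<And>z. 0 \<le> z \<Longrightarrow> 0 \<le> poly p z" and "p \<noteq> 0"
  shows "0 < wint p"
proof -
  let ?f = "\<lambda>z::real. indicator {0..} z * (exp (- z) * poly p z)"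
  have int: "integrable lborel ?f" and eq: "integral\<^sup>L lborel ?f = wint p"
    using has_integral_wint[of p] by (auto simp: has_bochner_integral_iff)
  have nonneg: "0 \<le> ?f z" for z
    using assms(1) by (simp add: indicator_def)
  have "wint p \<noteq> 0"
  proof
    assume "wint p = 0"
    then have "AE z in lborel. ?f z = 0"
      using integral_nonneg_eq_0_iff_AE[OF int] nonneg eq by simp
    moreover have "AE z in lborel. z \<notin> {z. poly p z = 0}"
      by (rule AE_not_in) (simp add: poly_roots_finite assms(2) finite_imp_null_set_lborel)
    \<comment> \<open>Off the finite root set the integrand is nonzero on the half-line, so an
      interval of positive length would be a null set.\<close>
    ultimately have "AE z in lborel. z \<notin> {0<..<1::real}"
      by eventually_elim (auto simp: indicator_def split: if_splits)
    then have "emeasure lborel {0<..<1::real} = 0"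
      by (subst (asm) AE_iff_measurable[of "{0<..<1}"]) auto
    then show False
      by simp
  qed
  moreover have "0 \<le> wint p"
    using Bochner_Integration.integral_nonneg[of lborel ?f] nonneg eq by simp
  ultimately show ?thesis
    by simp
qed

lemma wint_square_pos: "p \<noteq> 0 \<Longrightarrow> 0 < wint (p * p)"
  by (rule wint_pos) auto

lemma wint_square_eq_0: "wint (p * p) = 0 \<Longrightarrow> p = 0"
  using wint_square_pos[of p] by fastforce

section \<open>The moments \<open>Q\<close> and the laws of the kernels\<close>

abbreviation X :: "real poly" where "X \<equiv> [:0, 1:]"

lemma Q_eq_wint: "Q k a = wint (X ^ k * (a * a))"
  by (simp add: Q_def wint_def poly_power power2_eq_square mult_ac)

lemma Q_pos: "a \<noteq> 0 \<Longrightarrow> 0 < Q k a"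
  unfolding Q_eq_wint by (rule wint_pos) (auto simp: poly_power)

lemma Q_smult: "Q k (smult c a) = c\<^sup>2 * Q k a"
  by (simp add: Q_eq_wint power2_eq_square)

lemma kappa_smult: "c \<noteq> 0 \<Longrightarrow> kappa l (smult c a) = kappa l a"
  by (auto simp: kappa_def Q_smult power_mult_distrib)

lemma mean_one_scale_smult: "c \<noteq> 0 \<Longrightarrow> mean_one_scale (smult c a) = mean_one_scale a"
  by (simp add: mean_one_scale_def Q_smult)

lemma mean_one_scale_pos: "a \<noteq> 0 \<Longrightarrow> 0 < mean_one_scale a"
  by (simp add: mean_one_scale_def Q_pos)

lemma kappa_nonneg: "0 \<le> l \<Longrightarrow> a \<noteq> 0 \<Longrightarrow> 0 \<le> kappa l a u"
  by (simp add: kappa_def Q_pos less_imp_le)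

lemma poly_measurable [measurable]: "poly p \<in> borel_measurable borel" for p :: "real poly"
  by (intro borel_measurable_continuous_onI continuous_intros)

lemma kappa_measurable [measurable]: "kappa l a \<in> borel_measurable borel"
  unfolding kappa_def[abs_def] by measurable

lemma kappa_moment:
  assumes "0 < l"
  shows "has_bochner_integral lborel (\<lambda>u. kappa l a u * u ^ k) (Q k a / (l ^ k * Q 0 a))"
proof -
  let ?g = "\<lambda>z. indicator {0..} z * (exp (- z) * poly (X ^ k * (a * a)) z)"
  have "has_bochner_integral lborel (\<lambda>u. ?g (0 + l * u)) (Q k a /\<^sub>R \<bar>l\<bar>)"
    using lborel_has_bochner_integral_real_affine_iff[of l ?g "Q k a" 0]
      has_integral_wint[of "X ^ k * (a * a)"] assms
    unfolding Q_eq_wint by blast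
  \<comment> \<open>Under the substitution z = l u the prefactor \<open>l\<close> of the density
    absorbs the Jacobian, and \<open>l ^ k\<close> corrects u^k = (z / l)^k.\<close>
  then have *: "has_bochner_integral lborel (\<lambda>u. (l / (l ^ k * Q 0 a)) * ?g (0 + l * u))
      ((l / (l ^ k * Q 0 a)) * (Q k a /\<^sub>R \<bar>l\<bar>))"
    by (rule has_bochner_integral_mult_right)
  have "(\<lambda>u. (l / (l ^ k * Q 0 a)) * ?g (0 + l * u)) = (\<lambda>u. kappa l a u * u ^ k)"
    using assms
    by (auto simp: kappa_def indicator_def zero_le_mult_iff poly_power power2_eq_square
        power_mult_distrib fun_eq_iff)
  moreover have "(l / (l ^ k * Q 0 a)) * (Q k a /\<^sub>R \<bar>l\<bar>) = Q k a / (l ^ k * Q 0 a)"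
    using assms by (simp add: field_simps)
  ultimately show ?thesis
    using * by metis
qed

lemma law_moment:
  assumes "0 < l" and "a \<noteq> 0"
  shows "has_bochner_integral (law (kappa l a)) (\<lambda>u. u ^ k) (Q k a / (l ^ k * Q 0 a))"
  unfolding law_def
proof (rule has_bochner_integral_density)
  show "has_bochner_integral lborel (\<lambda>u. kappa l a u *\<^sub>R u ^ k) (Q k a / (l ^ k * Q 0 a))"
    using kappa_moment[OF assms(1)] by simp
qed (use assms in \<open>auto simp: kappa_nonneg\<close>)

lemma prob_space_law_kappa:
  assumes "0 < l" and "a \<noteq> 0"
  shows "prob_space (law (kappa l a))"
proof
  have "emeasure (law (kappa l a)) (space (law (kappa l a))) = (\<integral>\<^sup>+u. ennreal (kappa l a u) \<partial>lborel)"
    by (simp add: law_def emeasure_density)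
  also have "\<dots> = ennreal 1"
    using kappa_moment[OF assms(1), of a 0] Q_pos[OF assms(2), of 0] assms
    by (intro nn_integral_eq_integral[THEN trans]) 
      (auto simp: has_bochner_integral_iff kappa_nonneg)
  finally show "emeasure (law (kappa l a)) (space (law (kappa l a))) = 1"
    by simp
qed

lemma law_mean_kappa:
  assumes "0 < l" and "a \<noteq> 0"
  shows "law_mean (kappa l a) = Q 1 a / (l * Q 0 a)"
  using law_moment[OF assms, of 1] by (simp add: law_mean_def has_bochner_integral_iff)

lemma law_second_moment_kappa:
  assumes "0 < l" and "a \<noteq> 0"
  shows "prob_space.expectation (law (kappa l a)) (\<lambda>u. u\<^sup>2) = Q 2 a / (l\<^sup>2 * Q 0 a)"
  using law_moment[OF assms, of 2] by (simp add: has_bochner_integral_iff)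

lemma law_variance_kappa:
  assumes "0 < l" and "a \<noteq> 0"
  shows "law_variance (kappa l a) = Q 2 a / (l\<^sup>2 * Q 0 a) - (Q 1 a / (l * Q 0 a))\<^sup>2"
proof -
  interpret prob_space "law (kappa l a)"
    using prob_space_law_kappa[OF assms] .
  have "variance (\<lambda>u. u) = expectation (\<lambda>u. u\<^sup>2) - (expectation (\<lambda>u. u))\<^sup>2"
    using law_moment[OF assms, of 1] law_moment[OF assms, of 2]
    by (intro variance_eq) (auto simp: has_bochner_integral_iff)
  then show ?thesis
    using law_second_moment_kappa[OF assms] law_mean_kappa[OF assms]
    by (simp add: law_variance_def law_mean_def)
qed

text \<open>At the mean-one scale the squared mean subtracted in the variance is 1.\<close>

lemma objective_eq:
  assumes "a \<noteq> 0"
  shows "objective a = Q 0 a * Q 2 a / (Q 1 a)\<^sup>2 - 1"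
  using Q_pos[OF assms, of 0] Q_pos[OF assms, of 1]
  unfolding objective_def law_variance_kappa[OF mean_one_scale_pos[OF assms] assms]
  by (simp add: mean_one_scale_def field_simps power2_eq_square)

section \<open>Laguerre polynomials\<close>

lemma coeff_laguerre: "coeff (laguerre n) j = (-1) ^ j * real (n choose j) / fact j"
proof -
  have "coeff (laguerre n) j = (\<Sum>i\<le>n. if i = j then (-1) ^ j * real (n choose j) / fact j else 0)"
    unfolding laguerre_def coeff_sum by (intro sum.cong) auto
  then show ?thesis
    by (auto simp: binomial_eq_0)
qed

lemma degree_laguerre [simp]: "degree (laguerre n) = n"
proof (rule antisym)
  show "degree (laguerre n) \<le> n"
    by (rule degree_le) (simp add: coeff_laguerre binomial_eq_0)
  show "n \<le> degree (laguerre n)"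
    by (rule le_degree) (simp add: coeff_laguerre)
qed

lemma laguerre_nonzero [simp]: "laguerre n \<noteq> 0"
  using coeff_laguerre[of n n] by auto

lemma poly_laguerre_0 [simp]: "poly (laguerre n) 0 = 1"
  by (simp add: poly_0_coeff_0 coeff_laguerre)

text \<open>Coefficient by coefficient this is Pascal's rule.\<close>

lemma pderiv_laguerre_Suc: "pderiv (laguerre (Suc n)) = pderiv (laguerre n) - laguerre n"
proof (rule poly_eqI)
  fix j
  have "real (Suc j) * ((- 1) ^ Suc j * c / fact (Suc j)) = - ((- 1) ^ j * c / fact j)" for c
    by (simp add: fact_Suc del: of_nat_Suc)
  then show "coeff (pderiv (laguerre (Suc n))) j = coeff (pderiv (laguerre n) - laguerre n) j"
    by (simp only: coeff_pderiv coeff_diff coeff_laguerre binomial_Suc_Suc of_nat_add)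
      (simp add: field_simps)
qed

text \<open>Integrate by parts with both indices and subtract: every Laguerre polynomial is 1 at 0,
  so the two boundary terms p(0) cancel.\<close>

lemma wint_laguerre_Suc:
  "wint (laguerre (Suc n) * p) = wint (laguerre (Suc n) * pderiv p) - wint (laguerre n * pderiv p)"
  using wint_pderiv[of "laguerre (Suc n) * p"] wint_pderiv[of "laguerre n * p"]
  by (simp add: pderiv_mult pderiv_laguerre_Suc algebra_simps)

text \<open>The recurrence replaces p by its derivative. The term with the same index falls to an
  inner induction on the degree of p, the term with the smaller index to the outer induction on
  n.\<close>

lemma laguerre_orthogonal: "degree p < n \<Longrightarrow> wint (laguerre n * p) = 0"
proof (induction n arbitrary: p)
  case (Suc n)
  from Suc.prems show ?case
  proof (induction "degree p" arbitrary: p rule: less_induct)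
    case less
    have *: "pderiv p = 0 \<or> degree (pderiv p) < degree p"
      by (cases "degree p = 0") (auto simp: pderiv_eq_0_iff degree_pderiv)
    then have "wint (laguerre (Suc n) * pderiv p) = 0"
      using less by fastforce
    moreover have "wint (laguerre n * pderiv p) = 0"
      using * less.prems Suc.IH[of "pderiv p"] by fastforce
    ultimately show ?case
      using wint_laguerre_Suc[of n p] by simp
  qed
qed simp

lemma laguerre_unique:
  assumes "degree p = n" and orth: "\<And>q. degree q < n \<Longrightarrow> wint (p * q) = 0" and "p \<noteq> 0"
  shows "\<exists>c. c \<noteq> 0 \<and> p = smult c (laguerre n)"
\<comment> \<open>The general argument lowers the degree strictly below n, which is impossible for n
  = 0.\<close>
proof (cases "n = 0")
  case True
  then obtain c where "p = [:c:]"
    using assms(1) degree_eq_zeroE by metis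
  moreover have "laguerre 0 = 1"
    by (simp add: laguerre_def)
  ultimately show ?thesis
    using True assms(3) by (intro exI[of _ c]) auto
next
  case False
  define c where "c = lead_coeff p / lead_coeff (laguerre n)"
  have nz: "coeff (laguerre n) n \<noteq> 0"
    by (simp add: coeff_laguerre)
  then have "c \<noteq> 0"
    using assms(3) by (simp add: c_def)
  let ?d = "p - smult c (laguerre n)"
  have "degree ?d < n"
    using assms(1) False nz
    by (intro degree_lessI) (auto simp: c_def coeff_eq_0 le_less)
  \<comment> \<open>With the leading terms cancelled, both \<open>p\<close> and the Laguerre
    polynomial are orthogonal to the difference, so it is orthogonal to itself.\<close>
  then have "wint (?d * ?d) = 0"
    using orth[of ?d] laguerre_orthogonal[of ?d n]
    by (simp only: left_diff_distrib[of p] mult_smult_left wint_diff wint_smult)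
  then have "?d = 0"
    by (rule wint_square_eq_0)
  then show ?thesis
    using \<open>c \<noteq> 0\<close> by auto
qed

text \<open>If a factor \<open>f\<close> of \<open>laguerre n\<close> is nonnegative on the half-line, then orthogonality to the
  cofactor \<open>g\<close> contradicts the positivity of \<open>wint (f * g * g)\<close>.\<close>

lemma laguerre_no_nonneg_factor:
  assumes "laguerre n = f * g" and "\<And>z. 0 \<le> z \<Longrightarrow> 0 \<le> poly f z"
  shows "degree f = 0"
proof (rule ccontr)
  assume "degree f \<noteq> 0"
  have nz: "f \<noteq> 0" "g \<noteq> 0"
    using assms(1) laguerre_nonzero[of n] by auto
  have "degree g < n"
    using \<open>degree f \<noteq> 0\<close> degree_mult_eq[OF nz] degree_laguerre[of n] assms(1) by simp
  then have "wint (laguerre n * g) = 0"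
    by (rule laguerre_orthogonal)
  moreover have "0 < wint (f * (g * g))"
    using nz assms(2) by (intro wint_pos) auto
  ultimately show False
    by (simp add: assms(1) mult.assoc)
qed

lemma laguerre_root_pos:
  assumes "poly (laguerre n) x = 0"
  shows "0 < x"
proof (rule ccontr)
  assume "\<not> 0 < x"
  obtain g where "laguerre n = [:- x, 1:] * g"
    using assms by (metis dvdE poly_eq_0_iff_dvd)
  then show False
    using laguerre_no_nonneg_factor[of n "[:- x, 1:]" g] \<open>\<not> 0 < x\<close> by simp
qed

lemma laguerre_root_simple: "\<not> [:- x, 1:] * [:- x, 1:] dvd laguerre n"
proof
  assume "[:- x, 1:] * [:- x, 1:] dvd laguerre n"
  then obtain g where "laguerre n = ([:- x, 1:] * [:- x, 1:]) * g"
    by (auto elim: dvdE)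
  then have "degree ([:- x, 1:] * [:- x, 1:]) = 0"
    by (rule laguerre_no_nonneg_factor) (simp only: poly_mult zero_le_square)
  then show False
    by simp
qed

section \<open>Number and order of the zeros\<close>

abbreviation laguerre_roots :: "nat \<Rightarrow> real set" where
  "laguerre_roots n \<equiv> {t. poly (laguerre n) t = 0}"

lemma finite_laguerre_roots: "finite (laguerre_roots n)"
  by (simp add: poly_roots_finite)

lemma prod_linear_dvd:
  fixes p :: "'a::idom poly"
  assumes "finite S" and "\<And>x. x \<in> S \<Longrightarrow> poly p x = 0"
  shows "(\<Prod>x\<in>S. [:- x, 1:]) dvd p"
  using assms
proof (induction S arbitrary: p rule: finite_induct)
  case (insert y S)
  then obtain g where g: "p = [:- y, 1:] * g"
    by (metis dvdE insertI1 poly_eq_0_iff_dvd)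
  have "poly g x = 0" if "x \<in> S" for x
    using insert.prems[of x] insert.hyps that by (auto simp: g)
  then have "(\<Prod>x\<in>S. [:- x, 1:]) dvd g"
    by (rule insert.IH)
  then show ?case
    using insert.hyps by (simp add: g mult_dvd_mono del: mult_pCons_left)
qed simp

lemma poly_no_root_sign:
  fixes g :: "real poly"
  assumes "\<And>x. poly g x \<noteq> 0"
  shows "(\<forall>x. 0 < poly g x) \<or> (\<forall>x. poly g x < 0)"
proof (rule ccontr)
  assume "\<not> ?thesis"
  then obtain x y where "poly g x < 0" "0 < poly g y"
    using assms by (metis linorder_neqE_linordered_idom)
  then have "x \<noteq> y"
    by auto
  with \<open>poly g x < 0\<close> \<open>0 < poly g y\<close> show False
    using poly_IVT_pos[of x y g] poly_IVT_neg[of y x g] assms by (cases "x < y") auto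
qed

text \<open>Split off the linear factors of all real roots. A root of the cofactor would be a double
  root, so the cofactor has constant sign; it or its negative is then a nonnegative factor and hence
  constant.\<close>

lemma card_laguerre_roots: "card (laguerre_roots n) = n"
proof -
  let ?S = "laguerre_roots n"
  define h where "h = (\<Prod>x\<in>?S. [:- x, 1:])"
  have deg_h: "degree h = card ?S"
    unfolding h_def by (subst degree_prod_eq_sum_degree) auto
  obtain g where g: "laguerre n = h * g"
    using prod_linear_dvd[OF finite_laguerre_roots, of n "laguerre n"] unfolding h_def
    by (auto elim: dvdE)
  have nz: "h \<noteq> 0" "g \<noteq> 0"
    using g laguerre_nonzero[of n] by auto
  have "poly g x \<noteq> 0" for x
  proof
    assume "poly g x = 0"
    then have "x \<in> ?S"
      by (simp add: g)
    then have "[:- x, 1:] dvd h"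
      unfolding h_def by (rule dvd_prodI[OF finite_laguerre_roots])
    moreover have "[:- x, 1:] dvd g"
      using \<open>poly g x = 0\<close> by (simp add: poly_eq_0_iff_dvd)
    ultimately show False
      using laguerre_root_simple[of x n] g by (metis mult_dvd_mono)
  qed
  then consider "\<forall>x. 0 < poly g x" | "\<forall>x. poly g x < 0"
    using poly_no_root_sign[of g] by blast
  then have "degree g = 0"
  proof cases
    case 1
    then show ?thesis
      using laguerre_no_nonneg_factor[of n g h] g by (simp add: mult.commute less_imp_le)
  next
    case 2
    then have "degree (- g) = 0"
      using laguerre_no_nonneg_factor[of n "- g" "- h"] g by (simp add: mult.commute less_imp_le)
    then show ?thesis
      by simp
  qed
  then show ?thesis
    using deg_h degree_mult_eq[OF nz] g degree_laguerre[of n] by simp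
qed

lemma lzero_in_roots: "1 \<le> j \<Longrightarrow> j \<le> n \<Longrightarrow> lzero j n \<in> laguerre_roots n"
  using nth_mem[of "j - 1" "sorted_list_of_set (laguerre_roots n)"] card_laguerre_roots[of n]
    finite_laguerre_roots[of n]
  by (simp add: lzero_def)

lemma lzero_less:
  assumes "1 \<le> i" "i < j" "j \<le> n"
  shows "lzero i n < lzero j n"
proof -
  have "sorted_wrt (<) (sorted_list_of_set (laguerre_roots n))"
    by simp
  then show ?thesis
    using assms card_laguerre_roots[of n] by (simp add: lzero_def sorted_wrt_iff_nth_less)
qed

lemma lzero_pos: "1 \<le> j \<Longrightarrow> j \<le> n \<Longrightarrow> 0 < lzero j n"
  using laguerre_root_pos lzero_in_roots by blast

lemma laguerre_root_is_lzero:
  assumes "x \<in> laguerre_roots n"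
  shows "\<exists>j. 1 \<le> j \<and> j \<le> n \<and> x = lzero j n"
proof -
  have "x \<in> set (sorted_list_of_set (laguerre_roots n))"
    using assms finite_laguerre_roots[of n] by simp
  then obtain i where "i < n" "x = sorted_list_of_set (laguerre_roots n) ! i"
    using card_laguerre_roots[of n] by (auto simp: in_set_conv_nth)
  then show ?thesis
    by (intro exI[of _ "Suc i"]) (simp add: lzero_def)
qed

lemma adjacent_roots_are_consecutive:
  assumes "x \<in> laguerre_roots n" "y \<in> laguerre_roots n" "x < y"
    and "\<And>z. z \<in> laguerre_roots n \<Longrightarrow> x < z \<Longrightarrow> z < y \<Longrightarrow> False"
  obtains j where "1 \<le> j" "j < n" "x = lzero j n" "y = lzero (j + 1) n"
proof -
  obtain i where i: "1 \<le> i" "i \<le> n" "x = lzero i n"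
    using laguerre_root_is_lzero[OF assms(1)] by blast
  obtain j where j: "1 \<le> j" "j \<le> n" "y = lzero j n"
    using laguerre_root_is_lzero[OF assms(2)] by blast
  have "i < j"
    using i j assms(3) lzero_less[of j i n] by (cases i j rule: linorder_cases) auto
  moreover have "\<not> i + 1 < j"
    using assms(4)[OF lzero_in_roots[of "i + 1" n]] i j lzero_less[of i "i + 1" n]
      lzero_less[of "i + 1" j n] by auto
  ultimately have "j = i + 1"
    by simp
  then show ?thesis
    using that[of i] i j by simp
qed

section \<open>Laguerre polynomials with an adjacent pair of zeros deleted\<close>

lemma pair_poly_dvd:
  assumes "1 \<le> j" "j < n"
  shows "pair_poly j n dvd laguerre n"
proof -
  have "(\<Prod>x\<in>{lzero j n, lzero (j + 1) n}. [:- x, 1:]) dvd laguerre n"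
    using assms lzero_in_roots[of j n] lzero_in_roots[of "j + 1" n]
    by (intro prod_linear_dvd) auto
  moreover have "lzero j n \<noteq> lzero (j + 1) n"
    using assms lzero_less[of j "j + 1" n] by simp
  ultimately show ?thesis
    by (simp add: pair_poly_def del: mult_pCons_left)
qed

lemma pair_poly_mult_deleted_pair:
  assumes "1 \<le> j" "j < n"
  shows "pair_poly j n * deleted_pair j n = laguerre n"
  using pair_poly_dvd[OF assms] by (simp add: deleted_pair_def)

lemma deleted_pair_nonzero:
  assumes "1 \<le> j" "j < n"
  shows "deleted_pair j n \<noteq> 0"
  using pair_poly_mult_deleted_pair[OF assms] laguerre_nonzero[of n] by auto

lemma degree_pair_poly [simp]: "degree (pair_poly j n) = 2"
  unfolding pair_poly_def by (subst degree_mult_eq) auto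

lemma degree_deleted_pair:
  assumes "1 \<le> j" "j < n"
  shows "degree (deleted_pair j n) = n - 2"
proof -
  have "pair_poly j n \<noteq> 0"
    using degree_pair_poly[of j n] by (metis degree_0 zero_neq_numeral)
  then show ?thesis
    using degree_mult_eq[of "pair_poly j n" "deleted_pair j n"] deleted_pair_nonzero[OF assms]
      pair_poly_mult_deleted_pair[OF assms] by simp
qed

section \<open>Variations of the objective\<close>

lemma wint_by_parts:
  "wint (f * pderiv g) = wint (f * g) - wint (pderiv f * g) - poly f 0 * poly g 0"
  using wint_pderiv[of "f * g"] by (simp add: pderiv_mult algebra_simps)

text \<open>The product \<open>a * pderiv a\<close> is half the derivative of the square, and the
  weight vanishing at 0 removes the boundary term.\<close>

lemma wint_mult_pderiv_self:
  assumes "poly w 0 = 0"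
  shows "2 * wint (w * (a * pderiv a)) = wint (w * (a * a)) - wint (pderiv w * (a * a))"
proof -
  have "w * pderiv (a * a) = 2 * (w * (a * pderiv a))"
    by (simp add: pderiv_mult algebra_simps)
  then have "2 * wint (w * (a * pderiv a)) = wint (w * pderiv (a * a))"
    by (metis wint_numeral_mult)
  then show ?thesis
    using wint_by_parts[of w "a * a"] assms by simp
qed

lemma wint_perturb:
  "wint (P * ((a + smult e h) * (a + smult e h)))
     = wint (P * (a * a)) + 2 * e * wint (P * a * h) + e\<^sup>2 * wint (P * (h * h))"
proof -
  have "smult (2 * e) p = smult e p + smult e p" for p :: "real poly"
    by (simp flip: smult_add_left)
  then have "P * ((a + smult e h) * (a + smult e h))
      = P * (a * a) + smult (2 * e) (P * a * h) + smult (e\<^sup>2) (P * (h * h))"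
    by (simp add: ring_distribs power2_eq_square mult_ac)
  then show ?thesis
    by simp
qed

lemma linear_coefficient_zero:
  fixes b c :: real
  assumes "\<And>e. 0 \<le> e * b + e\<^sup>2 * c"
  shows "b = 0"
proof -
  \<comment> \<open>Any k > max(c, 0) serves: e = -b/k turns the expression into b^2 (c - k) / k^2,
    which is negative unless b = 0.\<close>
  define k where "k = \<bar>c\<bar> + 1"
  have "0 < k" "c < k"
    by (auto simp: k_def)
  have "0 \<le> (- b / k) * b + (- b / k)\<^sup>2 * c"
    by (rule assms)
  also have "\<dots> = b\<^sup>2 * (c - k) / k\<^sup>2"
    using \<open>0 < k\<close> by (simp add: field_simps power2_eq_square)
  finally have "0 \<le> b\<^sup>2 * (c - k)"
    using \<open>0 < k\<close> by (simp add: zero_le_divide_iff)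
  then show ?thesis
    using \<open>c < k\<close> by (simp add: zero_le_mult_iff)
qed

lemma quadratic_coefficient_nonneg:
  fixes A B C :: real
  assumes "\<And>e. 0 \<le> e\<^sup>2 * A + e ^ 3 * B + e ^ 4 * C"
  shows "0 \<le> A"
proof (rule ccontr)
  assume "\<not> 0 \<le> A"
  \<comment> \<open>Averaging over e and -e removes the cubic term.\<close>
  have even: "0 \<le> e\<^sup>2 * (A + e\<^sup>2 * C)" for e
    using assms[of e] assms[of "- e"] by (simp add: algebra_simps power_numeral_reduce)
  have "0 < C"
    using even[of 1] \<open>\<not> 0 \<le> A\<close> by simp
  \<comment> \<open>This e makes the bracket equal to A/2, which is negative.\<close>
  define e where "e = sqrt (- A / (2 * C))"
  have pos: "0 < - A / (2 * C)"
    using \<open>\<not> 0 \<le> A\<close> \<open>0 < C\<close> by (intro divide_pos_pos) auto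
  moreover have "e\<^sup>2 = - A / (2 * C)"
    unfolding e_def using pos by (intro real_sqrt_pow2 less_imp_le)
  ultimately have "0 < e\<^sup>2" "A + e\<^sup>2 * C = A / 2"
    using \<open>0 < C\<close> by auto
  then have "e\<^sup>2 * (A + e\<^sup>2 * C) < 0"
    using \<open>\<not> 0 \<le> A\<close> by (simp add: mult_pos_neg)
  then show False
    using even[of e] by simp
qed

lemma Q0_eq: "Q 0 a = wint (a * a)"
  by (simp add: Q_eq_wint)

lemma Q1_eq: "Q 1 a = wint (X * (a * a))"
  by (simp only: Q_eq_wint power_one_right)

lemma Q2_eq: "Q 2 a = wint (X * X * (a * a))"
  by (simp only: Q_eq_wint power2_eq_square)

lemma Q3_eq: "Q 3 a = wint (X * X * X * (a * a))"
  by (simp only: Q_eq_wint power3_eq_cube)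

lemma wint_cubic:
  "wint ([:c0, c1, c2, c3:] * (h * h)) = c0 * Q 0 h + c1 * Q 1 h + c2 * Q 2 h + c3 * Q 3 h"
proof -
  have "[:c0, c1, c2, c3:] = smult c0 1 + smult c1 X + smult c2 (X * X) + smult c3 (X * X * X)"
    by simp
  then have "[:c0, c1, c2, c3:] * (h * h)
      = smult c0 (h * h) + smult c1 (X * (h * h)) + smult c2 (X * X * (h * h))
        + smult c3 (X * X * X * (h * h))"
    by (simp only: distrib_right mult_smult_left mult_1)
  then show ?thesis
    unfolding Q0_eq Q1_eq Q2_eq Q3_eq by (simp only: wint_add wint_smult)
qed

lemma wint_quadratic: "wint ([:c0, c1, c2:] * (h * h)) = c0 * Q 0 h + c1 * Q 1 h + c2 * Q 2 h"
  using wint_cubic[of c0 c1 c2 0 h] by (simp only: pCons_0_0 mult_zero_left add_0_right)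

lemma wint_linear: "wint ([:c0, c1:] * (h * h)) = c0 * Q 0 h + c1 * Q 1 h"
  using wint_quadratic[of c0 c1 0 h] by (simp only: pCons_0_0 mult_zero_left add_0_right)

text \<open>Strict Cauchy-Schwarz: the weight (t - s)^2 about the mean s has positive integral
  against the square of a nonzero polynomial.\<close>

lemma Q1_square_less:
  assumes "a \<noteq> 0"
  shows "(Q 1 a)\<^sup>2 < Q 0 a * Q 2 a"
proof -
  define s where "s = Q 1 a / Q 0 a"
  have [simp]: "0 < Q 0 a" "Q 0 a \<noteq> 0"
    using Q_pos[OF assms, of 0] by auto
  have "0 < wint (([:- s, 1:] * [:- s, 1:]) * (a * a))"
  proof (rule wint_pos)
    show "0 \<le> poly ([:- s, 1:] * [:- s, 1:] * (a * a)) z" for z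
      by (simp only: poly_mult zero_le_square mult_nonneg_nonneg)
    show "[:- s, 1:] * [:- s, 1:] * (a * a) \<noteq> 0"
      using assms by (simp del: mult_pCons_left)
  qed
  also have "[:- s, 1:] * [:- s, 1:] = [:s\<^sup>2, - 2 * s, 1:]"
    by (simp add: power2_eq_square)
  finally have "0 < Q 2 a - 2 * s * Q 1 a + s\<^sup>2 * Q 0 a"
    by (simp only: wint_quadratic)
  then have "0 < Q 2 a - (Q 1 a)\<^sup>2 / Q 0 a"
    by (simp add: s_def field_simps power2_eq_square)
  then show ?thesis
    by (simp add: field_simps)
qed

lemma degree_pderiv_le: "degree (pderiv p) \<le> degree p - 1" for p :: "real poly"
  by (simp add: degree_pderiv)

text \<open>The direction \<open>k\<close> is the derivative at \<open>\<epsilon> = 0\<close> of \<open>exp (\<epsilon> t) a ((1 - \<epsilon>) t)\<close>.\<close>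

lemma second_variation_identity:
  fixes a R T :: "real poly"
  assumes T: "pderiv T = 1" "poly T 0 = 0"
  defines "k \<equiv> T * (a - pderiv a)" and "S \<equiv> 2 * R - T * pderiv R" and "w \<equiv> T * T * pderiv R"
  shows "2 * (wint (R * (k * k)) + 2 * wint (S * a * k))
    = 8 * wint (R * a * k) + 2 * wint (R * a * pderiv (k * T))
      - wint (w * (a * a)) - wint (pderiv w * (a * a))"
proof -
  have "wint (k * T * pderiv (R * a)) = wint (k * T * (R * a)) - wint (pderiv (k * T) * (R * a))"
    using wint_by_parts[of "k * T" "R * a"] T by simp
  \<comment> \<open>Writing one factor k as T (a - a') lets the terms with R a' and R' a merge into
    the derivative of R a. By parts it moves onto k T, leaving integrals of R a, which stationarity
    kills in the application.\<close>
  moreover have "R * (k * k) + S * a * k = 2 * (R * a * k) + (k * T * (R * a) - k * T * pderiv (R * a))"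
    by (simp add: k_def S_def pderiv_mult T algebra_simps)
  then have "wint (R * (k * k)) + wint (S * a * k)
      = 2 * wint (R * a * k) + (wint (k * T * (R * a)) - wint (k * T * pderiv (R * a)))"
    by (metis wint_add wint_diff wint_numeral_mult)
  moreover have "S * a * k = 2 * (R * a * k) - (w * (a * a) - w * (a * pderiv a))"
    by (simp add: k_def S_def w_def algebra_simps)
  then have "wint (S * a * k) = 2 * wint (R * a * k) - (wint (w * (a * a)) - wint (w * (a * pderiv a)))"
    by (metis wint_diff wint_numeral_mult)
  moreover have "2 * wint (w * (a * pderiv a)) = wint (w * (a * a)) - wint (pderiv w * (a * a))"
    by (rule wint_mult_pderiv_self) (simp add: w_def T)
  ultimately show ?thesis
    by (simp add: mult.commute)
qed

section \<open>Consequences of minimality\<close>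

locale variance_minimizer =
  fixes m :: nat and a :: "real poly"
  assumes minimizer: "global_minimizer m a"
begin

definition mu :: real where "mu = Q 2 a / Q 1 a"

text \<open>This is \<open>1 - rho a\<close>, the reciprocal of
  \<open>1 + objective a\<close>.\<close>

definition kap :: real where "kap = (Q 1 a)\<^sup>2 / (Q 0 a * Q 2 a)"

text \<open>The expanded form of (t - \<mu>)^2 - \<rho> \<mu>^2; explicit coefficients reduce its
  integrals against squares to the moments \<open>Q\<close>.\<close>

abbreviation R :: "real poly" where "R \<equiv> [:mu\<^sup>2 * kap, - 2 * mu, 1:]"

lemma a_nonzero: "a \<noteq> 0" and degree_a_le: "degree a \<le> m"
  using minimizer by (auto simp: global_minimizer_def)

lemma Q_a_pos [simp]: "0 < Q k a"
  by (rule Q_pos[OF a_nonzero])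

lemma mu_pos: "0 < mu"
  by (simp add: mu_def)

lemma kap_pos: "0 < kap"
  unfolding kap_def by (intro divide_pos_pos mult_pos_pos zero_less_power Q_a_pos)

lemma kap_less_1: "kap < 1"
  using Q1_square_less[OF a_nonzero] by (simp add: kap_def)

lemma Q1_a: "Q 1 a = mu * kap * Q 0 a"
  using Q_a_pos[of 0] Q_a_pos[of 1] Q_a_pos[of 2] unfolding mu_def kap_def
  by (simp add: field_simps power2_eq_square del: Q_a_pos)

lemma Q2_a: "Q 2 a = mu\<^sup>2 * kap * Q 0 a"
  using Q_a_pos[of 0] Q_a_pos[of 1] Q_a_pos[of 2] unfolding mu_def kap_def
  by (simp add: field_simps power2_eq_square del: Q_a_pos)

lemma objective_a: "objective a = 1 / kap - 1"
  using objective_eq[OF a_nonzero] by (simp add: kap_def)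

text \<open>Minimality bounds \<open>(Q 1 h)^2\<close> by \<open>kap * Q 0 h * Q 2 h\<close>, so as
  a quadratic in s the form has nonpositive discriminant. The case s = \<open>mu\<close> gives
  \<open>R\<close>; the freedom in s lets \<open>second_order\<close> vary the scale too.\<close>

lemma quadratic_form_nonneg:
  assumes "degree h \<le> m"
  shows "0 \<le> wint ([:s\<^sup>2 * kap, - 2 * s, 1:] * (h * h))"
proof (cases "h = 0")
  case False
  have pos: "0 < Q 0 h" "0 < Q 1 h" "0 < Q 2 h"
    using Q_pos[OF False] by auto
  have "objective a \<le> objective h"
    using minimizer False assms by (simp add: global_minimizer_def)
  then have "1 / kap \<le> Q 0 h * Q 2 h / (Q 1 h)\<^sup>2"
    using objective_a objective_eq[OF False] by simp
  then have "(Q 1 h)\<^sup>2 \<le> kap * (Q 0 h * Q 2 h)"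
    using pos kap_pos by (simp add: field_simps)
  \<comment> \<open>The square is completed after multiplying the form by
    \<open>kap * Q 0 h\<close>.\<close>
  then have "0 \<le> (s * kap * Q 0 h - Q 1 h)\<^sup>2 + (kap * (Q 0 h * Q 2 h) - (Q 1 h)\<^sup>2)"
    by simp
  also have "\<dots> = (kap * Q 0 h) * ((s\<^sup>2 * kap) * Q 0 h + (- 2 * s) * Q 1 h + 1 * Q 2 h)"
    by (simp add: power2_eq_square algebra_simps)
  finally have "0 \<le> (s\<^sup>2 * kap) * Q 0 h + (- 2 * s) * Q 1 h + 1 * Q 2 h"
    using mult_pos_pos[OF kap_pos pos(1)] by (metis mult_pos_neg not_le)
  then show ?thesis
    by (simp only: wint_quadratic)
qed simp

lemma wint_R_a_a: "wint (R * (a * a)) = 0"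
  unfolding wint_quadratic Q1_a Q2_a by (simp add: power2_eq_square)

lemma first_order:
  assumes "degree h \<le> m"
  shows "wint (R * a * h) = 0"
proof -
  have "0 \<le> e * (2 * wint (R * a * h)) + e\<^sup>2 * wint (R * (h * h))" for e
  proof -
    have "degree (a + smult e h) \<le> m"
      using assms degree_a_le by (intro degree_add_le) (auto intro: le_trans[OF degree_smult_le])
    then have "0 \<le> wint (R * ((a + smult e h) * (a + smult e h)))"
      by (rule quadratic_form_nonneg)
    then show ?thesis
      unfolding wint_perturb wint_R_a_a
      by (simp only: add_0_left mult.assoc mult.left_commute[of e 2])
  qed
  from linear_coefficient_zero[OF this] show ?thesis
    by simp
qed

text \<open>Move the polynomial to a + e k and the scale to \<open>mu * (1 + e)\<close> together.
  The terms of order 0 and 1 in e vanish, so the coefficient of e^2 is nonnegative.\<close>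

lemma second_order:
  assumes "degree k \<le> m"
  shows "0 \<le> wint (R * (k * k)) + 2 * wint ([:2 * mu\<^sup>2 * kap, - 2 * mu:] * a * k) + mu\<^sup>2 * kap * Q 0 a"
proof -
  let ?S = "[:2 * mu\<^sup>2 * kap, - 2 * mu:]" and ?P = "[:mu\<^sup>2 * kap:]"
  have S: "wint (?S * (a * a)) = 0"
    unfolding wint_linear Q1_a by (simp add: power2_eq_square)
  have P: "wint (?P * (a * a)) = mu\<^sup>2 * kap * Q 0 a"
    unfolding Q0_eq by (rule wint_const_mult)
  have "0 \<le> e\<^sup>2 * (wint (R * (k * k)) + 2 * wint (?S * a * k) + mu\<^sup>2 * kap * Q 0 a)
      + e ^ 3 * (wint (?S * (k * k)) + 2 * wint (?P * a * k)) + e ^ 4 * wint (?P * (k * k))" for e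
  proof -
    let ?h = "a + smult e k" and ?s = "mu * (1 + e)"
    have "degree ?h \<le> m"
      using assms degree_a_le by (intro degree_add_le) (auto intro: le_trans[OF degree_smult_le])
    then have "0 \<le> wint ([:?s\<^sup>2 * kap, - 2 * ?s, 1:] * (?h * ?h))"
      by (rule quadratic_form_nonneg)
    also have "[:?s\<^sup>2 * kap, - 2 * ?s, 1:] = R + smult e ?S + smult (e\<^sup>2) ?P"
      by (simp add: power2_eq_square algebra_simps)
    also have "wint (\<dots> * (?h * ?h)) = wint (R * (?h * ?h)) + e * wint (?S * (?h * ?h)) + e\<^sup>2 * wint (?P * (?h * ?h))"
      by (simp only: distrib_right mult_smult_left wint_add wint_smult)
    finally show ?thesis
      unfolding wint_perturb wint_R_a_a S P first_order[OF assms]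
      by (simp add: algebra_simps power_numeral_reduce)
  qed
  then show ?thesis
    by (rule quadratic_coefficient_nonneg)
qed

lemma degree_a: "degree a = m"
proof (rule ccontr)
  assume "degree a \<noteq> m"
  then have "degree a < m"
    using degree_a_le by simp
  define k where "k = X * (a - pderiv a)"
  have "degree (a - pderiv a) \<le> degree a"
    by (intro degree_diff_le) (auto intro: order_trans[OF degree_pderiv_le])
  then have deg_k: "degree k \<le> m"
    using \<open>degree a < m\<close> degree_mult_le[of X "a - pderiv a"] unfolding k_def by simp
  have deg_kX: "degree (pderiv (k * X)) \<le> m"
    using degree_pderiv_le[of "k * X"] degree_mult_le[of k X] deg_k by simp
  have deg_Xa: "degree (X * a) \<le> m"
    using \<open>degree a < m\<close> degree_mult_le[of X a] by simp

  \<comment> \<open>The direction \<open>X * a\<close> is admissible only under the assumption that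
    the degree is below m; it expresses the third moment through lower ones.\<close>
  have "wint (R * a * (X * a)) = 0"
    by (rule first_order[OF deg_Xa])
  moreover have "R * a * (X * a) = (X * R) * (a * a)"
    by (simp only: mult_ac)
  moreover have "X * R = [:0, mu\<^sup>2 * kap, - 2 * mu, 1:]"
    by simp
  ultimately have "wint ([:0, mu\<^sup>2 * kap, - 2 * mu, 1:] * (a * a)) = 0"
    by metis
  then have Q3: "Q 3 a = 2 * mu * Q 2 a - mu\<^sup>2 * kap * Q 1 a"
    unfolding wint_cubic by simp

  \<comment> \<open>\<open>R\<close> is homogeneous of degree 2 in t and \<open>mu\<close> jointly,
    so by Euler's relation 2 R - t R' is \<open>mu\<close> times its derivative in
    \<open>mu\<close>, the weight occurring in \<open>second_order\<close>.\<close>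
  have S: "2 * R - X * pderiv R = [:2 * mu\<^sup>2 * kap, - 2 * mu:]"
    by (simp add: pderiv_pCons numeral_poly)
  have w: "X * X * pderiv R = [:0, 0, - 2 * mu, 2:]"
    by (simp add: pderiv_pCons)
  have w': "pderiv [:0, 0, - 2 * mu, 2:] = [:0, - 4 * mu, 6:]"
    by (simp add: pderiv_pCons)
  have X: "pderiv X = 1" "poly X 0 = 0"
    by (auto simp: pderiv_pCons)
  have "2 * (wint (R * (k * k)) + 2 * wint ([:2 * mu\<^sup>2 * kap, - 2 * mu:] * a * k))
      = - wint ([:0, 0, - 2 * mu, 2:] * (a * a)) - wint ([:0, - 4 * mu, 6:] * (a * a))"
    using second_variation_identity[OF X, where R = R and a = a, folded k_def, unfolded S w w']
    unfolding first_order[OF deg_k] first_order[OF deg_kX] by simp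
  moreover have "2 * (u + 2 * v) = w \<Longrightarrow> 0 \<le> u + 2 * v + q \<Longrightarrow> 0 \<le> w + 2 * q" for u v w q :: real
    by auto
  ultimately have "0 \<le> - wint ([:0, 0, - 2 * mu, 2:] * (a * a)) - wint ([:0, - 4 * mu, 6:] * (a * a))
      + 2 * (mu\<^sup>2 * kap * Q 0 a)"
    using second_order[OF deg_k] by metis
  \<comment> \<open>With all moments reduced to \<open>Q 0 a\<close>, the terms quadratic in
    \<open>mu\<close> cancel and a strictly negative cubic one remains.\<close>
  also have "\<dots> = - (2 * mu ^ 3 * kap * (1 - kap) * Q 0 a)"
    unfolding wint_cubic wint_quadratic Q3 Q2_a Q1_a
    by (simp add: algebra_simps power2_eq_square power3_eq_cube)
  also have "\<dots> < 0"
    using mu_pos kap_pos kap_less_1 by simp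
  finally show False
    by simp
qed

text \<open>The extra degree comes from testing stationarity with \<open>X * pderiv a\<close>, the generator of dilations.\<close>

lemma wint_R_a_eq_0:
  assumes "degree h \<le> m + 1"
  shows "wint (R * a * h) = 0"
proof -
  have deg: "degree (X * pderiv a) \<le> m"
  proof (cases "pderiv a = 0")
    case False
    then have "degree a \<noteq> 0"
      by (simp add: pderiv_eq_0_iff)
    then show ?thesis
      using degree_mult_le[of X "pderiv a"] degree_pderiv_le[of a] degree_a by simp
  qed simp
  have "2 * wint ((X * R) * (a * pderiv a)) = wint ((X * R) * (a * a)) - wint (pderiv (X * R) * (a * a))"
    by (rule wint_mult_pderiv_self) simp
  moreover have "(X * R) * (a * pderiv a) = R * a * (X * pderiv a)"
    by (simp only: mult_ac)
  moreover have "pderiv (X * R) = [:mu\<^sup>2 * kap, - 4 * mu, 3:]"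
    by (simp add: pderiv_pCons)
  \<comment> \<open>By the moment relations the three terms are 1, -4 and 3 times
    \<open>mu^2 * kap * Q 0 a\<close>.\<close>
  moreover have "wint ([:mu\<^sup>2 * kap, - 4 * mu, 3:] * (a * a)) = 0"
    unfolding wint_quadratic Q1_a Q2_a by (simp add: power2_eq_square)
  moreover have "(X * R) * (a * a) = R * a * (X * a)"
    by (simp only: mult_ac)
  ultimately have Xa: "wint (R * a * (X * a)) = 0"
    using first_order[OF deg] by simp

  \<comment> \<open>Subtracting this multiple of \<open>X * a\<close> cancels the coefficient of
    degree m + 1 and leaves a direction covered by \<open>first_order\<close>.\<close>
  define c where "c = coeff h (m + 1) / lead_coeff a"
  have "degree (h - smult c (X * a)) \<le> m"
  proof (rule degree_le, safe)
    fix i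
    assume "m < i"
    show "coeff (h - smult c (X * a)) i = 0"
    proof (cases "i = m + 1")
      case True
      moreover have "coeff a m \<noteq> 0"
        using a_nonzero degree_a by (metis leading_coeff_0_iff)
      ultimately show ?thesis
        using degree_a by (simp add: c_def)
    next
      case False
      then have "m + 1 < i"
        using \<open>m < i\<close> by simp
      moreover have "degree (X * a) \<le> m + 1"
        using degree_mult_le[of X a] degree_a by simp
      ultimately show ?thesis
        using assms by (simp add: coeff_eq_0 del: mult_pCons_left)
    qed
  qed
  then have "wint (R * a * (h - smult c (X * a))) = 0"
    by (rule first_order)
  moreover have "wint (R * a * (h - smult c (X * a))) = wint (R * a * h) - c * wint (R * a * (X * a))"
    by (simp only: right_diff_distrib wint_diff mult_smult_right wint_smult)
  ultimately show ?thesis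
    using Xa by simp
qed

lemma R_mult_a: "\<exists>c. c \<noteq> 0 \<and> R * a = smult c (laguerre (m + 2))"
proof (rule laguerre_unique)
  have "R \<noteq> 0"
    by simp
  then show "degree (R * a) = m + 2"
    using degree_mult_eq[OF _ a_nonzero, of R] degree_a by simp
  show "R * a \<noteq> 0"
    using \<open>R \<noteq> 0\<close> a_nonzero by (simp del: mult_pCons_left)
qed (rule wint_R_a_eq_0, simp)

definition x where "x = mu - mu * sqrt (1 - kap)"

definition y where "y = mu + mu * sqrt (1 - kap)"

lemma x_less_y: "x < y"
  using mu_pos kap_less_1 by (simp add: x_def y_def)

lemma R_factor: "R = [:- x, 1:] * [:- y, 1:]"
  using kap_less_1 by (simp add: x_def y_def algebra_simps power2_eq_square)

lemma poly_R: "poly R z = (z - x) * (z - y)"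
  unfolding R_factor poly_mult by simp

lemma poly_R_mult_a_eq_0_iff: "poly (laguerre (m + 2)) z = 0 \<longleftrightarrow> poly R z = 0 \<or> poly a z = 0"
  using R_mult_a by (metis mult_eq_0_iff poly_mult poly_smult)

lemma no_root_between:
  assumes "z \<in> laguerre_roots (m + 2)" "x < z" "z < y"
  shows False
proof -
  have neg: "poly R z < 0"
    unfolding poly_R using assms by (simp add: mult_pos_neg)
  then have "poly a z = 0"
    using assms(1) poly_R_mult_a_eq_0_iff by auto
  then obtain h where h: "a = [:- z, 1:] * h"
    by (metis dvdE poly_eq_0_iff_dvd)
  have "h \<noteq> 0"
    using a_nonzero h by auto
  then have deg_h: "degree a = degree h + 1"
    unfolding h by (subst degree_mult_eq) auto
  let ?p = "R * h" and ?S = "[:z - 2 * mu, 1:]"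
  \<comment> \<open>Division of \<open>R\<close> by t - z with remainder R(z); the factor t - z then
    recombines with h into \<open>a\<close>, and the cross term is killed by orthogonality.\<close>
  have R_split: "R = [:poly R z:] + [:- z, 1:] * ?S"
    by (simp add: algebra_simps)
  have "?p * ?p = ?p * (([:poly R z:] + [:- z, 1:] * ?S) * h)"
    using R_split by metis
  also have "\<dots> = [:poly R z:] * (R * (h * h)) + R * a * (?S * h)"
    by (simp only: h ring_distribs mult_ac)
  finally have "wint (?p * ?p) = wint ([:poly R z:] * (R * (h * h))) + wint (R * a * (?S * h))"
    by (simp only: wint_add)
  moreover have "wint (R * a * (?S * h)) = 0"
    using degree_mult_le[of ?S h] deg_h degree_a by (intro wint_R_a_eq_0) simp
  ultimately have "wint (?p * ?p) = poly R z * wint (R * (h * h))"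
    by (simp only: wint_const_mult)
  moreover have "0 \<le> wint (R * (h * h))"
    using deg_h degree_a by (intro quadratic_form_nonneg) simp
  moreover have "0 < wint (?p * ?p)"
    using \<open>h \<noteq> 0\<close> by (intro wint_square_pos) (simp del: mult_pCons_left)
  ultimately show False
    using neg by (metis mult_nonpos_nonneg less_imp_le not_le)
qed

lemma consecutive_zeros:
  obtains j c where "1 \<le> j" "j < m + 2" "R = pair_poly j (m + 2)" "c \<noteq> 0"
    "a = smult c (deleted_pair j (m + 2))"
proof -
  have "x \<in> laguerre_roots (m + 2)" "y \<in> laguerre_roots (m + 2)"
    using poly_R_mult_a_eq_0_iff poly_R by auto
  then obtain j where j: "1 \<le> j" "j < m + 2" "x = lzero j (m + 2)" "y = lzero (j + 1) (m + 2)"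
    using adjacent_roots_are_consecutive x_less_y no_root_between by metis
  have R: "R = pair_poly j (m + 2)"
    unfolding R_factor j(3,4) pair_poly_def ..
  obtain c where c: "c \<noteq> 0" "R * a = smult c (laguerre (m + 2))"
    using R_mult_a by blast
  have "R * a = R * smult c (deleted_pair j (m + 2))"
    using c(2) pair_poly_mult_deleted_pair[OF j(1,2)] R by (metis mult_smult_right)
  moreover have "R \<noteq> 0"
    by simp
  ultimately have "a = smult c (deleted_pair j (m + 2))"
    using mult_left_cancel by blast
  then show ?thesis
    using that j c R by blast
qed

end

text \<open>Orthogonality of the Laguerre polynomial to b, to t b and t b', and to b' gives three
  linear equations for the moments. The last one is inhomogeneous through its boundary term at 0 and
  fixes the normalization.\<close>

lemma deleted_pair_moments:
  assumes j: "1 \<le> j" "j < n"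
  defines "x \<equiv> lzero j n" and "y \<equiv> lzero (j + 1) n" and "b \<equiv> deleted_pair j n"
  shows "Q 0 b = (x + y) / (x * y * (y - x)\<^sup>2)"
    and "Q 1 b = 2 * x * y / (x + y) * Q 0 b"
    and "Q 2 b = x * y * Q 0 b"
proof -
  have xy: "0 < x" "x < y"
    using lzero_pos[of j n] lzero_less[of j "j + 1" n] j by (auto simp: x_def y_def)
  let ?R = "[:x * y, - (x + y), 1:]"
  have "?R = pair_poly j n"
    by (simp add: pair_poly_def x_def y_def algebra_simps)
  then have L: "?R * b = laguerre n"
    using pair_poly_mult_deleted_pair[OF j] unfolding b_def by metis
  have deg_b: "degree b = n - 2"
    using degree_deleted_pair[OF j] by (simp add: b_def)
  have orth: "wint (?R * b * h) = 0" if "degree h < n" for h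
    unfolding L by (rule laguerre_orthogonal[OF that])
  have "2 \<le> n"
    using j by simp
  \<comment> \<open>For n = 2 the truncated bound is 0, and \<open>X * pderiv b\<close> still has
    degree below n.\<close>
  have b': "degree (pderiv b) \<le> n - 3"
    using degree_pderiv_le[of b] deg_b by simp

  have "wint (?R * b * b) = 0"
    using deg_b \<open>2 \<le> n\<close> by (intro orth) simp
  then have zero: "wint (?R * (b * b)) = 0"
    by (simp only: mult.assoc)
  then have eq1: "x * y * Q 0 b - (x + y) * Q 1 b + Q 2 b = 0"
    unfolding wint_quadratic by (simp add: algebra_simps)

  have "wint (?R * b * (X * pderiv b)) = 0"
    using degree_mult_le[of X "pderiv b"] b' \<open>2 \<le> n\<close> by (intro orth) simp
  moreover have "wint (?R * b * (X * b)) = 0"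
    using degree_mult_le[of X b] deg_b \<open>2 \<le> n\<close> by (intro orth) simp
  moreover have "2 * wint ((X * ?R) * (b * pderiv b))
      = wint ((X * ?R) * (b * b)) - wint (pderiv (X * ?R) * (b * b))"
    by (rule wint_mult_pderiv_self) simp
  moreover have "(X * ?R) * (b * pderiv b) = ?R * b * (X * pderiv b)" "(X * ?R) * (b * b) = ?R * b * (X * b)"
    by (simp_all only: mult_ac)
  moreover have "pderiv (X * ?R) = [:x * y, - 2 * (x + y), 3:]"
    by (simp add: pderiv_pCons)
  ultimately have "wint ([:x * y, - 2 * (x + y), 3:] * (b * b)) = 0"
    by simp
  then have eq2: "x * y * Q 0 b - 2 * (x + y) * Q 1 b + 3 * Q 2 b = 0"
    unfolding wint_quadratic by (simp add: algebra_simps)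

  \<comment> \<open>Evaluate the factorization at 0, where the Laguerre polynomial is 1.\<close>
  have "x * y * poly b 0 = 1"
    using arg_cong[OF L, of "\<lambda>p. poly p 0"] unfolding poly_mult by simp
  then have b0: "poly b 0 = 1 / (x * y)"
    using xy by (simp add: field_simps)
  have "wint (?R * b * pderiv b) = 0"
    using b' \<open>2 \<le> n\<close> by (intro orth) simp
  moreover have "?R * pderiv (b * b) = 2 * (?R * b * pderiv b)"
    by (simp only: pderiv_mult) (simp add: algebra_simps del: mult_pCons_left)
  ultimately have "wint (?R * pderiv (b * b)) = 0"
    by (simp only: wint_numeral_mult)
  moreover have "pderiv ?R = [:- (x + y), 2:]"
    by (simp add: pderiv_pCons)
  ultimately have "wint ([:- (x + y), 2:] * (b * b)) + x * y * (1 / (x * y))\<^sup>2 = 0"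
    using wint_by_parts[of ?R "b * b"] zero b0 by (simp add: power2_eq_square)
  then have eq3: "(x + y) * Q 0 b - 2 * Q 1 b = 1 / (x * y)"
    unfolding wint_linear using xy by (simp add: power2_eq_square algebra_simps)

  show Q2: "Q 2 b = x * y * Q 0 b"
    using eq1 eq2 by (simp add: algebra_simps)
  show Q1: "Q 1 b = 2 * x * y / (x + y) * Q 0 b"
    using eq1 Q2 xy by (simp add: field_simps)
  have "Q 0 b * ((x + y)\<^sup>2 - 4 * x * y) = (x + y) / (x * y)"
    using eq3 xy unfolding Q1 by (simp add: field_simps power2_eq_square)
  moreover have "(x + y)\<^sup>2 - 4 * x * y = (y - x)\<^sup>2"
    by (simp add: power2_eq_square algebra_simps)
  ultimately show "Q 0 b = (x + y) / (x * y * (y - x)\<^sup>2)"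
    using xy by (simp add: field_simps)
qed

section \<open>Optimal kernels\<close>

lemma objective_smult: "c \<noteq> 0 \<Longrightarrow> objective (smult c a) = objective a"
  by (simp add: objective_def kappa_smult mean_one_scale_smult)

context
  fixes j n :: nat
  assumes j: "1 \<le> j" "j < n"
begin

lemma lzero_pair: "0 < lzero j n" "lzero j n < lzero (j + 1) n"
  using lzero_pos[of j n] lzero_less[of j "j + 1" n] j by auto

lemma mean_one_scale_deleted_pair: "mean_one_scale (deleted_pair j n) = pair_scale j n"
  using deleted_pair_moments(2)[OF j] Q_pos[OF deleted_pair_nonzero[OF j], of 0]
  by (simp add: mean_one_scale_def pair_scale_def Let_def)

lemma pair_const_eq: "pair_const j n = 1 / Q 0 (deleted_pair j n)"
  unfolding deleted_pair_moments(1)[OF j] by (simp add: pair_const_def Let_def)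

lemma kappa_deleted_pair:
  "kappa l (deleted_pair j n) u
    = (if 0 \<le> u then l * pair_const j n * exp (- (l * u)) * (poly (deleted_pair j n) (l * u))\<^sup>2 else 0)"
  by (simp add: kappa_def pair_const_eq)

lemma objective_deleted_pair: "objective (deleted_pair j n) = gap j n"
proof -
  let ?x = "lzero j n" and ?y = "lzero (j + 1) n" and ?q = "Q 0 (deleted_pair j n)"
  have q: "0 < ?q"
    by (rule Q_pos[OF deleted_pair_nonzero[OF j]])
  have "objective (deleted_pair j n) = ?q * (?x * ?y * ?q) / (2 * ?x * ?y / (?x + ?y) * ?q)\<^sup>2 - 1"
    unfolding objective_eq[OF deleted_pair_nonzero[OF j]] deleted_pair_moments(2,3)[OF j] ..
  also have "\<dots> = (?x + ?y)\<^sup>2 / (4 * ?x * ?y) - 1"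
    using lzero_pair q by (simp add: field_simps power2_eq_square)
  also have "\<dots> = gap j n"
    using lzero_pair unfolding gap_def by (simp add: field_simps power2_eq_square)
  finally show ?thesis .
qed

end

lemma kappa_deleted_pair_optimal:
  assumes "1 \<le> j" "j < m + 2"
  shows "kappa (pair_scale j (m + 2)) (deleted_pair j (m + 2)) = optimal_kernel m j"
  by (rule ext) (simp only: kappa_deleted_pair[OF assms] optimal_kernel_def)

section \<open>How far a kernel determines its scale and half-polynomial\<close>

lemma poly_times_exp_tendsto_0:
  fixes p :: "real poly"
  assumes "0 < d"
  shows "((\<lambda>u. poly p u * exp (- (d * u))) \<longlongrightarrow> 0) at_top"
proof (induction p rule: poly_monom_induct)
  case (monom c k)
  have "((\<lambda>u. (d * u) ^ k / exp (d * u)) \<longlongrightarrow> 0) at_top"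
    by (rule filterlim_compose[OF tendsto_power_div_exp_0])
      (rule filterlim_tendsto_pos_mult_at_top[OF tendsto_const assms filterlim_ident])
  then have "((\<lambda>u. c / d ^ k * ((d * u) ^ k / exp (d * u))) \<longlongrightarrow> c / d ^ k * 0) at_top"
    by (intro tendsto_mult tendsto_const)
  moreover have "(\<lambda>u. c / d ^ k * ((d * u) ^ k / exp (d * u))) = (\<lambda>u. poly (monom c k) u * exp (- (d * u)))"
    using assms by (auto simp: poly_monom power_mult_distrib exp_minus field_simps)
  ultimately show ?case
    by simp
next
  case (add p q)
  then show ?case
    using tendsto_add[OF add] by (simp add: algebra_simps)
qed

lemma poly_neq_poly_times_exp:
  fixes p q :: "real poly"
  assumes "0 < d" "p \<noteq> 0" and eq: "\<And>u. 0 \<le> u \<Longrightarrow> poly p u = poly q u * exp (- (d * u))"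
  shows False
proof -
  \<comment> \<open>Multiplying both sides by t makes the left polynomial nonconstant, hence
    divergent even if p is constant.\<close>
  have "((\<lambda>u. poly (X * q) u * exp (- (d * u))) \<longlongrightarrow> 0) at_top"
    by (rule poly_times_exp_tendsto_0[OF assms(1)])
  moreover have "eventually (\<lambda>u. poly (X * q) u * exp (- (d * u)) = poly (X * p) u) at_top"
    using eventually_ge_at_top[of 0] by eventually_elim (simp add: eq)
  ultimately have "(poly (X * p) \<longlongrightarrow> 0) at_top"
    by (rule Lim_transform_eventually)
  moreover have "filterlim (poly (X * p)) at_infinity at_top"
    using assms(2) by (intro filterlim_mono[OF filterlim_poly_at_infinity order_refl at_top_le_at_infinity])
      (simp add: degree_mult_eq)
  ultimately show False
    by (intro not_tendsto_and_filterlim_at_infinity[of at_top "poly (X * p)" 0]) auto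
qed

text \<open>If l < l', multiplying the two densities by exp (l u) would equate a nonzero polynomial
  with a polynomial times a decaying exponential. Exchanging the roles gives equality of the
  scales.\<close>

lemma kappa_eq_scale_le:
  assumes "0 < l" "0 < l'" "p \<noteq> 0" "q \<noteq> 0" and eq: "kappa l p = kappa l' q"
  shows "l' \<le> l"
proof (rule ccontr)
  assume "\<not> l' \<le> l"
  let ?P = "smult (l / Q 0 p) (pcompose (p * p) [:0, l:])"
  let ?Q = "smult (l' / Q 0 q) (pcompose (q * q) [:0, l':])"
  have "poly ?P u = poly ?Q u * exp (- ((l' - l) * u))" if "0 \<le> u" for u
  proof -
    have "exp (- (l * u)) * poly ?P u = exp (- (l' * u)) * poly ?Q u"
      using fun_cong[OF eq, of u] that by (simp add: kappa_def poly_pcompose power2_eq_square mult_ac)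
    then have "exp (l * u) * (exp (- (l * u)) * poly ?P u) = exp (l * u) * (exp (- (l' * u)) * poly ?Q u)"
      by simp
    then show ?thesis
      by (simp only: mult.assoc[symmetric] exp_add[symmetric]) (simp add: algebra_simps)
  qed
  moreover have "pcompose (p * p) [:0, l:] \<noteq> 0"
    using assms(1,3) by (simp add: pcompose_eq_0_iff)
  then have "?P \<noteq> 0"
    using assms(1,3) Q_pos[of p 0] by simp
  ultimately show False
    using poly_neq_poly_times_exp[of "l' - l" ?P ?Q] \<open>\<not> l' \<le> l\<close> by simp
qed

lemma kappa_eq_imp_proportional:
  assumes "0 < l" "0 < l'" "p \<noteq> 0" "q \<noteq> 0" and eq: "kappa l p = kappa l' q"
  shows "\<exists>C. C \<noteq> 0 \<and> p = smult C q"
proof -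
  have "l' = l"
    using kappa_eq_scale_le[OF assms] kappa_eq_scale_le[OF assms(2,1,4,3) eq[symmetric]] by simp
  have pos: "0 < Q 0 p" "0 < Q 0 q"
    using Q_pos assms(3,4) by auto
  \<comment> \<open>The factor s compensates for the normalizations, so p^2 and (s q)^2 agree on the
    half-line. They are then equal as polynomials, which forces p = s q or p = - s q.\<close>
  define s where "s = sqrt (Q 0 p / Q 0 q)"
  have s: "0 < s" "s * s = Q 0 p / Q 0 q"
    using pos by (auto simp: s_def)
  let ?d = "p * p - smult s q * smult s q"
  have "poly ?d t = 0" if "0 \<le> t" for t
  proof -
    have "(l * exp (- t)) * ((poly p t)\<^sup>2 / Q 0 p) = (l * exp (- t)) * ((poly q t)\<^sup>2 / Q 0 q)"
      using fun_cong[OF eq, of "t / l"] \<open>l' = l\<close> assms(1) that by (simp add: kappa_def)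
    moreover have "l * exp (- t) \<noteq> 0"
      using assms(1) by simp
    ultimately have "(poly p t)\<^sup>2 / Q 0 p = (poly q t)\<^sup>2 / Q 0 q"
      using mult_left_cancel by blast
    then have "(poly p t)\<^sup>2 = (s * s) * (poly q t)\<^sup>2"
      unfolding s using pos by (simp add: field_simps)
    then show ?thesis
      by (simp add: power2_eq_square mult_ac)
  qed
  then have "{0..} \<subseteq> {t. poly ?d t = 0}"
    by auto
  then have "?d = 0"
    using poly_roots_finite[of ?d] infinite_Ici[of "0::real"] finite_subset by blast
  then have "p = smult s q \<or> p = - smult s q"
    by (simp only: right_minus_eq square_eq_iff)
  then show ?thesis
    using s(1) by (metis smult_minus_left neg_equal_0_iff_equal less_irrefl)
qed

section \<open>The minimal value as the smallest gap\<close>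

context variance_minimizer
begin

lemma optimal_pair:
  obtains j c where "1 \<le> j" "j < m + 2" "R = pair_poly j (m + 2)" "c \<noteq> 0"
    "a = smult c (deleted_pair j (m + 2))" "gap j (m + 2) = min_gap (m + 2)"
    "objective a = min_gap (m + 2)"
proof -
  obtain j c where j: "1 \<le> j" "j < m + 2" and R: "R = pair_poly j (m + 2)" and c: "c \<noteq> 0"
    and a: "a = smult c (deleted_pair j (m + 2))"
    using consecutive_zeros by blast
  have gap: "objective a = gap j (m + 2)"
    unfolding a objective_smult[OF c] by (rule objective_deleted_pair[OF j])
  \<comment> \<open>Every deleted pair gives a polynomial of degree m whose objective is its gap, so
    all pairs compete with the minimizer.\<close>
  have "gap j (m + 2) \<le> gap r (m + 2)" if "r \<in> {1..<m + 2}" for r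
    using minimizer that degree_deleted_pair[of r "m + 2"] deleted_pair_nonzero[of r "m + 2"]
      objective_deleted_pair[of r "m + 2"] gap
    by (auto simp: global_minimizer_def)
  then have "min_gap (m + 2) = gap j (m + 2)"
    unfolding min_gap_def using j by (intro Min_eqI) auto
  then show ?thesis
    using that[of j c] j R c a gap by simp
qed

lemma objective_a_le: "b \<noteq> 0 \<Longrightarrow> degree b \<le> m \<Longrightarrow> objective a \<le> objective b"
  using minimizer by (simp add: global_minimizer_def)

text \<open>The minimizer over degree at most m has exact degree m, so it also attains the infimum
  over exact degree.\<close>

lemma optimal_variance_eq: "optimal_variance m = objective a"
  unfolding optimal_variance_def
  by (rule cInf_eq_minimum) (use a_nonzero degree_a objective_a_le in auto)

lemma R_eq: "[:- (Q 2 a / Q 1 a), 1:]\<^sup>2 - [:rho a * (Q 2 a / Q 1 a)\<^sup>2:] = R"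
proof -
  have rho: "rho a = 1 - kap"
    by (simp add: rho_def kap_def)
  show ?thesis
    unfolding mu_def[symmetric] rho by (simp add: power2_eq_square algebra_simps)
qed

end

lemma Q_const: "Q k [:C:] = C\<^sup>2 * fact k"
proof -
  have "X ^ k * ([:C:] * [:C:]) = monom (C\<^sup>2) k"
    by (simp add: monom_altdef power2_eq_square)
  then show ?thesis
    by (simp only: Q_eq_wint wint_monom)
qed

lemma law_kappa_mean_one:
  assumes "a \<noteq> 0"
  shows "law_mean (kappa (mean_one_scale a) a) = 1"
  using Q_pos[OF assms, of 0] Q_pos[OF assms, of 1]
  unfolding law_mean_kappa[OF mean_one_scale_pos[OF assms] assms]
  by (simp add: mean_one_scale_def)

lemma set_integral_kappa:
  assumes "0 < l" "a \<noteq> 0"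
  shows "(LINT u:{0..}|lborel. kappa l a u) = 1"
proof -
  have "(\<lambda>u. indicat_real {0..} u *\<^sub>R kappa l a u) = (\<lambda>u. kappa l a u * u ^ 0)"
    by (auto simp: kappa_def fun_eq_iff)
  then show ?thesis
    using kappa_moment[OF assms(1), of a 0] Q_pos[OF assms(2), of 0]
    by (simp only: set_lebesgue_integral_def has_bochner_integral_iff) simp
qed

theorem theorem6p6:
  fixes m n :: nat and a R :: "real poly" and mu eta :: real
  assumes minimizer: "global_minimizer m a"
  defines "n \<equiv> m + 2"
    and "mu \<equiv> Q 2 a / Q 1 a"
    and "eta \<equiv> rho a * mu\<^sup>2"
    and "R \<equiv> [:- mu, 1:]\<^sup>2 - [:eta:]"
  shows "degree a = m \<and>
    (\<exists>c. c \<noteq> 0 \<and> R * a = smult c (laguerre n)) \<and>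
    optimal_variance m = objective a \<and>
    objective a = min_gap n \<and>
    min_gap n = Min ((\<lambda>r. (lzero (r + 1) n - lzero r n)\<^sup>2 / (4 * lzero r n * lzero (r + 1) n))
                      ` {1..m + 1}) \<and>
    (m = 0 \<longrightarrow> optimal_variance 0 = 1 \<and> min_gap 2 = 1 \<and> (\<exists>C. C \<noteq> 0 \<and> a = [:C:]) \<and>
       (\<forall>u\<ge>0. kappa (mean_one_scale a) a u = exp (- u))) \<and>
    (\<exists>j\<in>{1..m + 1}. \<exists>x y.
       x = lzero j n \<and> y = lzero (j + 1) n \<and>
       R = [:- x, 1:] * [:- y, 1:] \<and>
       (\<exists>C. C \<noteq> 0 \<and> a = smult C (deleted_pair j n)) \<and>
       gap j n = min_gap n \<and>
       (\<forall>z\<ge>0. kappa 1 a z =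
          x * y * (y - x)\<^sup>2 / (x + y) * exp (- z) * (poly (deleted_pair j n) z)\<^sup>2) \<and>
       prob_space (law (kappa 1 a)) \<and>
       prob_space.expectation (law (kappa 1 a)) (\<lambda>t. t) = 2 * x * y / (x + y) \<and>
       prob_space.expectation (law (kappa 1 a)) (\<lambda>t. t\<^sup>2) = x * y \<and>
       mean_one_scale a = 2 * x * y / (x + y) \<and>
       kappa (2 * x * y / (x + y)) a = optimal_kernel m j \<and>
       (LINT u:{0..}|lborel. optimal_kernel m j u) = 1 \<and>
       prob_space (law (optimal_kernel m j)) \<and>
       law_mean (optimal_kernel m j) = 1 \<and>
       law_variance (optimal_kernel m j) = gap j n \<and>
       (\<forall>k\<in>mean_one_kernels m. law_variance (optimal_kernel m j) \<le> law_variance k)) \<and>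
    (\<forall>k\<in>mean_one_kernels m.
       (\<forall>k'\<in>mean_one_kernels m. law_variance k \<le> law_variance k') \<longrightarrow>
       (\<exists>i\<in>{1..m + 1}. gap i n = min_gap n \<and> k = optimal_kernel m i \<and>
          (\<forall>b. b \<noteq> 0 \<longrightarrow>
             (kappa (mean_one_scale b) b = k \<longleftrightarrow>
              (\<exists>C. C \<noteq> 0 \<and> b = smult C (deleted_pair i n))))))"
proof -
  interpret opt: variance_minimizer m a
    by unfold_locales (rule minimizer)
  have "R = [:- (Q 2 a / Q 1 a), 1:]\<^sup>2 - [:rho a * (Q 2 a / Q 1 a)\<^sup>2:]"
    by (simp only: R_def eta_def mu_def)
  note R_eq = this[unfolded opt.R_eq]
  obtain j c where j: "1 \<le> j" "j < n" and pair: "R = pair_poly j n" and c: "c \<noteq> 0"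
    and a: "a = smult c (deleted_pair j n)" and gap: "gap j n = min_gap n"
    and obj: "objective a = min_gap n"
    using opt.optimal_pair unfolding n_def R_eq by metis
  define b where "b = deleted_pair j n"
  define x where "x = lzero j n"
  define y where "y = lzero (j + 1) n"
  have b: "b \<noteq> 0" "degree b = m"
    using deleted_pair_nonzero[OF j] degree_deleted_pair[OF j] by (auto simp: b_def n_def)
  have xy: "0 < x" "x < y"
    using lzero_pair[OF j] by (auto simp: x_def y_def)
  have scale: "pair_scale j n = 2 * x * y / (x + y)"
    by (simp add: pair_scale_def x_def y_def Let_def)
  have const: "pair_const j n = x * y * (y - x)\<^sup>2 / (x + y)"
    by (simp add: pair_const_def x_def y_def Let_def)
  have scale_b: "mean_one_scale b = pair_scale j n"
    unfolding b_def by (rule mean_one_scale_deleted_pair[OF j])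
  have scale_pos: "0 < pair_scale j n"
    using mean_one_scale_pos[OF b(1)] scale_b by simp
  have kernel: "optimal_kernel m j = kappa (pair_scale j n) b"
    using kappa_deleted_pair_optimal[of j m] j by (simp add: n_def b_def)
  have kappa_a: "kappa l a = kappa l b" for l
    unfolding a b_def by (rule kappa_smult[OF c])
  have Q_b: "Q 1 b = 2 * x * y / (x + y) * Q 0 b" "Q 2 b = x * y * Q 0 b"
    unfolding b_def x_def y_def using deleted_pair_moments[OF j] by auto
  have Q0_b: "0 < Q 0 b"
    by (rule Q_pos[OF b(1)])
  have var: "law_variance (optimal_kernel m j) = gap j n"
    unfolding kernel using objective_deleted_pair[OF j] scale_b by (simp add: objective_def b_def)
  have le: "law_variance (optimal_kernel m j) \<le> law_variance k" if "k \<in> mean_one_kernels m" for k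
    using that opt.objective_a_le var gap obj by (auto simp: mean_one_kernels_def objective_def)

  have "\<exists>c. c \<noteq> 0 \<and> R * a = smult c (laguerre n)"
    using opt.R_mult_a unfolding R_eq n_def .
  moreover have "min_gap n = Min ((\<lambda>r. (lzero (r + 1) n - lzero r n)\<^sup>2 / (4 * lzero r n * lzero (r + 1) n))
      ` {1..m + 1})"
  proof -
    have "{1..<n} = {1..m + 1}"
      by (auto simp: n_def)
    then show ?thesis
      by (simp only: min_gap_def gap_def)
  qed
  moreover have "optimal_variance 0 = 1 \<and> min_gap 2 = 1 \<and> (\<exists>C. C \<noteq> 0 \<and> a = [:C:]) \<and>
      (\<forall>u\<ge>0. kappa (mean_one_scale a) a u = exp (- u))" if "m = 0"
  proof -
    have "degree a = 0"
      using opt.degree_a that by simp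
    then obtain C where C: "a = [:C:]"
      by (rule degree_eq_zeroE)
    then have "C \<noteq> 0"
      using opt.a_nonzero by auto
    \<comment> \<open>For a constant the moments are proportional to 1, 1, 2.\<close>
    then have "objective a = 1"
      using objective_eq[of a] unfolding C Q_const by (simp add: field_simps power2_eq_square)
    moreover have "kappa (mean_one_scale a) a u = exp (- u)" if "0 \<le> u" for u
      using that \<open>C \<noteq> 0\<close> unfolding C kappa_def mean_one_scale_def Q_const by simp
    moreover have "n = 2"
      using \<open>m = 0\<close> by (simp add: n_def)
    ultimately show ?thesis
      using opt.optimal_variance_eq obj \<open>m = 0\<close> C \<open>C \<noteq> 0\<close> by simp
  qed
  moreover have "\<exists>j\<in>{1..m + 1}. \<exists>x y.
       x = lzero j n \<and> y = lzero (j + 1) n \<and>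
       R = [:- x, 1:] * [:- y, 1:] \<and>
       (\<exists>C. C \<noteq> 0 \<and> a = smult C (deleted_pair j n)) \<and>
       gap j n = min_gap n \<and>
       (\<forall>z\<ge>0. kappa 1 a z =
          x * y * (y - x)\<^sup>2 / (x + y) * exp (- z) * (poly (deleted_pair j n) z)\<^sup>2) \<and>
       prob_space (law (kappa 1 a)) \<and>
       prob_space.expectation (law (kappa 1 a)) (\<lambda>t. t) = 2 * x * y / (x + y) \<and>
       prob_space.expectation (law (kappa 1 a)) (\<lambda>t. t\<^sup>2) = x * y \<and>
       mean_one_scale a = 2 * x * y / (x + y) \<and>
       kappa (2 * x * y / (x + y)) a = optimal_kernel m j \<and>
       (LINT u:{0..}|lborel. optimal_kernel m j u) = 1 \<and>
       prob_space (law (optimal_kernel m j)) \<and>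
       law_mean (optimal_kernel m j) = 1 \<and>
       law_variance (optimal_kernel m j) = gap j n \<and>
       (\<forall>k\<in>mean_one_kernels m. law_variance (optimal_kernel m j) \<le> law_variance k)"
  proof (rule bexI[of _ j], rule exI[of _ x], rule exI[of _ y], intro conjI allI ballI impI)
    show "R = [:- x, 1:] * [:- y, 1:]"
      unfolding pair pair_poly_def x_def y_def ..
    show "\<exists>C. C \<noteq> 0 \<and> a = smult C (deleted_pair j n)"
      using a c by blast
    show "kappa 1 a z = x * y * (y - x)\<^sup>2 / (x + y) * exp (- z) * (poly (deleted_pair j n) z)\<^sup>2"
      if "0 \<le> z" for z
      using that by (simp add: kappa_a b_def kappa_deleted_pair[OF j] const)
    show "prob_space (law (kappa 1 a))"
      by (rule prob_space_law_kappa[OF zero_less_one opt.a_nonzero])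
    show "prob_space.expectation (law (kappa 1 a)) (\<lambda>t. t) = 2 * x * y / (x + y)"
      using law_mean_kappa[OF zero_less_one b(1)] Q_b(1) Q0_b
      unfolding kappa_a law_mean_def by simp
    show "prob_space.expectation (law (kappa 1 a)) (\<lambda>t. t\<^sup>2) = x * y"
      unfolding kappa_a law_second_moment_kappa[OF zero_less_one b(1)] Q_b(2) using Q0_b by simp
    show "mean_one_scale a = 2 * x * y / (x + y)"
      using mean_one_scale_smult[OF c] scale_b scale by (simp add: a b_def)
    show "kappa (2 * x * y / (x + y)) a = optimal_kernel m j"
      by (simp only: kernel kappa_a scale)
    show "(LINT u:{0..}|lborel. optimal_kernel m j u) = 1"
      unfolding kernel by (rule set_integral_kappa[OF scale_pos b(1)])
    show "prob_space (law (optimal_kernel m j))"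
      unfolding kernel by (rule prob_space_law_kappa[OF scale_pos b(1)])
    show "law_mean (optimal_kernel m j) = 1"
      unfolding kernel scale_b[symmetric] by (rule law_kappa_mean_one[OF b(1)])
  qed (use j gap var le in \<open>auto simp: x_def y_def n_def\<close>)
  moreover have "\<exists>i\<in>{1..m + 1}. gap i n = min_gap n \<and> k = optimal_kernel m i \<and>
      (\<forall>b. b \<noteq> 0 \<longrightarrow>
        (kappa (mean_one_scale b) b = k \<longleftrightarrow> (\<exists>C. C \<noteq> 0 \<and> b = smult C (deleted_pair i n))))"
    if k: "k \<in> mean_one_kernels m"
      and min: "\<forall>k'\<in>mean_one_kernels m. law_variance k \<le> law_variance k'" for k
  proof -
    obtain p where p: "p \<noteq> 0" "degree p = m" "k = kappa (mean_one_scale p) p"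
      using k by (auto simp: mean_one_kernels_def)
    have "kappa (mean_one_scale a) a \<in> mean_one_kernels m"
      using opt.a_nonzero opt.degree_a by (auto simp: mean_one_kernels_def)
    then have "objective p \<le> objective a"
      using min p(3) by (simp add: objective_def)
    \<comment> \<open>Doing at least as well as \<open>a\<close>, the half-polynomial p is itself a
      global minimizer, so the structure found for minimizers applies to it.\<close>
    then have "global_minimizer m p"
      using p opt.objective_a_le by (auto simp: global_minimizer_def intro: order_trans)
    then interpret p: variance_minimizer m p
      by unfold_locales
    obtain i d where i: "1 \<le> i" "i < n" and d: "d \<noteq> 0" "p = smult d (deleted_pair i n)"
      and gap_i: "gap i n = min_gap n"
      using p.optimal_pair unfolding n_def by metis
    have q: "deleted_pair i n \<noteq> 0" "0 < pair_scale i n"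
      using deleted_pair_nonzero[OF i] mean_one_scale_pos mean_one_scale_deleted_pair[OF i]
      by metis+
    have scaled: "kappa (mean_one_scale b) b = optimal_kernel m i"
      if "C \<noteq> 0" "b = smult C (deleted_pair i n)" for C b
      using that kappa_deleted_pair_optimal[of i m] i
      by (simp add: kappa_smult mean_one_scale_smult mean_one_scale_deleted_pair n_def)
    have k_eq: "k = optimal_kernel m i"
      using scaled[OF d] p(3) by simp
    \<comment> \<open>Here b may have any degree: equality of the densities alone forces equal
      scales and proportional half-polynomials.\<close>
    have "\<exists>C. C \<noteq> 0 \<and> b = smult C (deleted_pair i n)"
      if "b \<noteq> 0" "kappa (mean_one_scale b) b = k" for b
      using that kappa_deleted_pair_optimal[of i m] i k_eq
      by (intro kappa_eq_imp_proportional[OF mean_one_scale_pos[OF that(1)] q(2) that(1) q(1)])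
        (simp add: n_def)
    then show ?thesis
      using i gap_i k_eq scaled by (intro bexI[of _ i]) (auto simp: n_def)
  qed
  ultimately show ?thesis
    using opt.degree_a opt.optimal_variance_eq obj by blast
qed

end
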